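(* Let $Q$ be a double coset separable group, let $Z$ be a finitely generated group, and let $G$ be a central extension of $Q$ by $Z$, i.e. there is a short exact sequence $1 \to Z \to G \to Q \to 1$ with the image of $Z$ contained in the centre of $G$. Then $G$ is double coset separable if and only if $G$ is subgroup separable.
   Context: The profinite topology on a group $G$ has as a basis of open sets the cosets of finite index subgroups of $G$. A subset of $G$ is separable if it is closed in the profinite topology on $G$. A group is subgroup separable if each of its finitely generated subgroups is separable. A group $G$ is double coset separable if for all finitely generated subgroups $H, K \leqslant G$ the double coset $HK$ is separable in $G$ (equivalently, all double cosets $HgK$ with $g\in G$ are separable). *)

theory Defs
  imports "HOL-Algebra.Generated_Groups" "HOL-Analysis.Abstract_Topology"
begin

definition finite_index_subgroup :: "('a, 'b) monoid_scheme \<Rightarrow> 'a set \<Rightarrow> bool" where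
  "finite_index_subgroup G N \<longleftrightarrow> subgroup N G \<and> finite (rcosets\<^bsub>G\<^esub> N)"

(* Right cosets suffice: the left coset gN is the right coset (gNg^-1)g, and conjugates of N
   again have finite index. *)
definition profinite_topology :: "('a, 'b) monoid_scheme \<Rightarrow> 'a topology" where
  "profinite_topology G =
     topology (arbitrary union_of
       (\<lambda>C. \<exists>N. finite_index_subgroup G N \<and> C \<in> rcosets\<^bsub>G\<^esub> N))"

definition separable_in :: "('a, 'b) monoid_scheme \<Rightarrow> 'a set \<Rightarrow> bool" where
  "separable_in G S \<longleftrightarrow> closedin (profinite_topology G) S"

definition fg_subgroup :: "('a, 'b) monoid_scheme \<Rightarrow> 'a set \<Rightarrow> bool" where
  "fg_subgroup G H \<longleftrightarrow> (\<exists>S. finite S \<and> S \<subseteq> carrier G \<and> H = generate G S)"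

definition fg_group :: "('a, 'b) monoid_scheme \<Rightarrow> bool" where
  "fg_group G \<longleftrightarrow> group G \<and> fg_subgroup G (carrier G)"

definition subgroup_separable :: "('a, 'b) monoid_scheme \<Rightarrow> bool" where
  "subgroup_separable G \<longleftrightarrow> group G \<and> (\<forall>H. fg_subgroup G H \<longrightarrow> separable_in G H)"

definition double_coset_separable :: "('a, 'b) monoid_scheme \<Rightarrow> bool" where
  "double_coset_separable G \<longleftrightarrow>
     group G \<and>
     (\<forall>H K. fg_subgroup G H \<longrightarrow> fg_subgroup G K \<longrightarrow> separable_in G (H <#>\<^bsub>G\<^esub> K))"

definition group_centre :: "('a, 'b) monoid_scheme \<Rightarrow> 'a set" where
  "group_centre G =
     {z \<in> carrier G. \<forall>g \<in> carrier G. z \<otimes>\<^bsub>G\<^esub> g = g \<otimes>\<^bsub>G\<^esub> z}"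

(* The library's short_exact_sequence forces all groups to have the same element type, so
   exactness of 1 -> Z -> G -> Q -> 1 is spelled out here. *)
definition central_extension ::
  "('z, 'c) monoid_scheme \<Rightarrow> ('g, 'd) monoid_scheme \<Rightarrow> ('q, 'e) monoid_scheme
     \<Rightarrow> ('z \<Rightarrow> 'g) \<Rightarrow> ('g \<Rightarrow> 'q) \<Rightarrow> bool" where
  "central_extension Z G Q i p \<longleftrightarrow>
     group Z \<and> group G \<and> group Q \<and>
     i \<in> mon Z G \<and> p \<in> epi G Q \<and>
     i ` carrier Z = kernel G Q p \<and>
     i ` carrier Z \<subseteq> group_centre G"

lemma finite_index_subgroup_Int:
  assumes "group G" "finite_index_subgroup G M" "finite_index_subgroup G N"
  shows "finite_index_subgroup G (M \<inter> N)"
proof -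
  interpret group G by fact
  have M: "subgroup M G" "finite (rcosets\<^bsub>G\<^esub> M)"
    and N: "subgroup N G" "finite (rcosets\<^bsub>G\<^esub> N)"
    using assms by (auto simp: finite_index_subgroup_def)
  have MN: "(M \<inter> N) #>\<^bsub>G\<^esub> x = (M #>\<^bsub>G\<^esub> x) \<inter> (N #>\<^bsub>G\<^esub> x)" if "x \<in> carrier G" for x
    using that subgroup.subset[OF M(1)] subgroup.subset[OF N(1)]
    by (auto simp: r_coset_def subset_iff)
  have "rcosets\<^bsub>G\<^esub> (M \<inter> N) \<subseteq> (\<lambda>(A, B). A \<inter> B) ` ((rcosets\<^bsub>G\<^esub> M) \<times> (rcosets\<^bsub>G\<^esub> N))"
    proof
    fix C assume "C \<in> rcosets\<^bsub>G\<^esub> (M \<inter> N)"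
    then obtain x where x: "x \<in> carrier G" "C = (M \<inter> N) #>\<^bsub>G\<^esub> x"
      by (auto simp: RCOSETS_def)
    then have "(M #>\<^bsub>G\<^esub> x, N #>\<^bsub>G\<^esub> x) \<in> (rcosets\<^bsub>G\<^esub> M) \<times> (rcosets\<^bsub>G\<^esub> N)"
      by (auto simp: RCOSETS_def)
    with MN[OF x(1)] x(2) show "C \<in> (\<lambda>(A, B). A \<inter> B) ` ((rcosets\<^bsub>G\<^esub> M) \<times> (rcosets\<^bsub>G\<^esub> N))"
      by (metis (mono_tags, lifting) case_prod_conv imageI)
  qed
  then have "finite (rcosets\<^bsub>G\<^esub> (M \<inter> N))"
    using M N by (meson finite_SigmaI finite_imageI finite_subset)
  then show ?thesis
    using subgroups_Inter_pair[OF M(1) N(1)] by (simp add: finite_index_subgroup_def)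
qed

(* The constant topology is only meaningful on predicates satisfying istopology; this lemma
   shows that the cosets of finite-index subgroups do form a base. *)
lemma openin_profinite_topology:
  assumes "group G"
  shows "openin (profinite_topology G) =
     arbitrary union_of (\<lambda>C. \<exists>N. finite_index_subgroup G N \<and> C \<in> rcosets\<^bsub>G\<^esub> N)"
    (is "_ = arbitrary union_of ?P")
proof -
  interpret group G by fact
  have "(arbitrary union_of ?P) (A \<inter> B)" if PA: "?P A" and PB: "?P B" for A B
  proof -
    obtain M N where M: "finite_index_subgroup G M" "A \<in> rcosets\<^bsub>G\<^esub> M"
      and N: "finite_index_subgroup G N" "B \<in> rcosets\<^bsub>G\<^esub> N"
      using PA PB by blast
    have sM: "subgroup M G" and sN: "subgroup N G"
      using M N by (auto simp: finite_index_subgroup_def)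
    have "\<exists>C. ?P C \<and> x \<in> C \<and> C \<subseteq> A \<inter> B" if x: "x \<in> A" "x \<in> B" for x
    proof -
      have xG: "x \<in> carrier G"
        using x(1) M(2) subgroup.rcosets_carrier[OF sM assms] by blast
      have "A = M #>\<^bsub>G\<^esub> x" "B = N #>\<^bsub>G\<^esub> x"
        using M(2) N(2) x sM sN repr_independence by (auto simp: RCOSETS_def)
      then have "(M \<inter> N) #>\<^bsub>G\<^esub> x \<subseteq> A \<inter> B"
        by (auto simp: r_coset_def)
      moreover have "x \<in> (M \<inter> N) #>\<^bsub>G\<^esub> x"
        using xG rcos_self subgroups_Inter_pair[OF sM sN] by blast
      moreover have "?P ((M \<inter> N) #>\<^bsub>G\<^esub> x)"
        using finite_index_subgroup_Int[OF assms M(1) N(1)] xG by (auto simp: RCOSETS_def)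
      ultimately show ?thesis by blast
    qed
    then show ?thesis
      unfolding arbitrary_union_of_alt by (meson Int_iff arbitrary_union_of_inc)
  qed
  then have "istopology (arbitrary union_of ?P)"
    by (auto simp: istopology_base_eq)
  then show ?thesis
    unfolding profinite_topology_def by (rule topology_inverse')
qed

lemma topspace_profinite_topology:
  assumes "group G"
  shows "topspace (profinite_topology G) = carrier G"
proof -
  interpret group G by fact
  have "openin (profinite_topology G) C"
    if "finite_index_subgroup G N" "C \<in> rcosets\<^bsub>G\<^esub> N" for C N
    using that unfolding openin_profinite_topology[OF assms]
    by (auto intro: arbitrary_union_of_inc)
  moreover have "rcosets\<^bsub>G\<^esub> (carrier G) = {carrier G}"
    using coset_join2[OF _ subgroup_self] one_closed by (auto simp: RCOSETS_def)
  ultimately have "openin (profinite_topology G) (carrier G)"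
    using subgroup_self by (metis finite_index_subgroup_def finite.emptyI finite.insertI singletonI)
  moreover have "U \<subseteq> carrier G" if "openin (profinite_topology G) U" for U
  proof
    fix x assume "x \<in> U"
    with that obtain N C where "finite_index_subgroup G N" "C \<in> rcosets\<^bsub>G\<^esub> N" "x \<in> C"
      unfolding openin_profinite_topology[OF assms] arbitrary_union_of_alt by blast
    then show "x \<in> carrier G"
      using subgroup.rcosets_carrier[OF _ assms] by (auto simp: finite_index_subgroup_def)
  qed
  ultimately show ?thesis
    by (simp add: openin_subset subset_antisym)
qed

end

(* The hard direction: separate g from HK, where H and K are finitely generated. If the image of g
   in Q avoids the image of HK, use separability in Q; otherwise translate so that g = z lies in Z.
   Centrality makes T = HK \<inter> Z a subgroup of Z, hence finitely generated, hence separable in G, so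
   some normal subgroup N of finite index satisfies Nz \<inter> T = {}. The set HK \<inter> Nz is a finite union
   of sets r (H \<inter> N) (K \<inter> N) s, and H \<inter> N, K \<inter> N are finitely generated by Schreier's lemma, so
   its image in Q is a finite union of translates of separable double cosets. That image misses 1
   because T misses Nz; a finite-index subgroup M of Q avoiding it yields the finite-index subgroup
   N \<inter> p^{-1}(M) separating z from HK. *)
theory Submission
  imports Defs
begin

section \<open>Finite-index subgroups and the working form of separability\<close>

context group
begin

text \<open>Stated in the right-associated form that \<open>m_assoc\<close> produces, so that
  \<open>simp\<close> can cancel an element against its inverse inside a long product.\<close>

lemma mult_inv_cancel:
  assumes "x \<in> carrier G" "y \<in> carrier G"
  shows "x \<otimes> (inv x \<otimes> y) = y" "inv x \<otimes> (x \<otimes> y) = y"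
  using assms by (simp_all add: m_assoc[symmetric])

text \<open>Equal values of \<open>f\<close> force equal right cosets, so the coset is a function of
  the value and there are at most as many cosets as values. This avoids constructing an injection on
  the cosets themselves.\<close>

lemma finite_index_subgroupI:
  assumes N: "subgroup N G" and fin: "finite (f ` carrier G)"
    and sep: "\<And>x y. x \<in> carrier G \<Longrightarrow> y \<in> carrier G \<Longrightarrow> f x = f y \<Longrightarrow> x \<otimes> inv y \<in> N"
  shows "finite_index_subgroup G N"
proof -
  let ?r = "\<lambda>c. N #> (SOME x. x \<in> carrier G \<and> f x = c)"
  have "rcosets N \<subseteq> ?r ` f ` carrier G"
  proof
    fix C assume "C \<in> rcosets N"
    then obtain x where x: "x \<in> carrier G" "C = N #> x"
      by (auto simp: RCOSETS_def)
    define y where "y = (SOME y. y \<in> carrier G \<and> f y = f x)"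
    have y: "y \<in> carrier G" "f y = f x"
      using someI[of "\<lambda>y. y \<in> carrier G \<and> f y = f x" x] x(1) by (auto simp: y_def)
    then have "y \<in> N #> x"
      using sep[of y x] x(1) subgroup.rcos_module[OF N is_group] by blast
    then have "C = ?r (f x)"
      using repr_independence[OF _ x(1) N] x(2) by (simp add: y_def)
    with x(1) show "C \<in> ?r ` f ` carrier G" by blast
  qed
  with fin N show ?thesis
    unfolding finite_index_subgroup_def by (meson finite_imageI finite_subset)
qed

lemma r_coset_eq_iff:
  assumes "subgroup N G" "x \<in> carrier G" "y \<in> carrier G"
  shows "N #> x = N #> y \<longleftrightarrow> x \<otimes> inv y \<in> N"
  using assms by (metis rcos_self repr_independence subgroup.rcos_module is_group)

text \<open>The core \<open>C\<close> is the kernel of the action of the group on the right cosets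
  of \<open>N\<close> by right multiplication. There are only finitely many self-maps of a finite
  set of cosets, so \<open>C\<close> has finite index.\<close>

lemma finite_index_normal_core:
  assumes "finite_index_subgroup G N"
  obtains C where "C \<lhd> G" "finite_index_subgroup G C" "C \<subseteq> N"
proof -
  have N: "subgroup N G" and fin: "finite (rcosets N)"
    using assms by (auto simp: finite_index_subgroup_def)
  define C where "C = {x \<in> carrier G. \<forall>g \<in> carrier G. g \<otimes> x \<otimes> inv g \<in> N}"
  have sub: "subgroup C G"
  proof (rule subgroupI)
    show "C \<subseteq> carrier G" by (auto simp: C_def)
    have "\<one> \<in> C" using subgroup.one_closed[OF N] by (auto simp: C_def)
    then show "C \<noteq> {}" by blast
  next
    fix x assume x: "x \<in> C"
    have "g \<otimes> inv x \<otimes> inv g \<in> N" if g: "g \<in> carrier G" for g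
    proof -
      have "inv (g \<otimes> x \<otimes> inv g) \<in> N"
        using x g subgroup.m_inv_closed[OF N] by (auto simp: C_def)
      then show ?thesis using x g by (simp add: C_def inv_mult_group m_assoc)
    qed
    then show "inv x \<in> C" using x by (auto simp: C_def)
  next
    fix x y assume x: "x \<in> C" and y: "y \<in> C"
    have "g \<otimes> (x \<otimes> y) \<otimes> inv g \<in> N" if g: "g \<in> carrier G" for g
    proof -
      have "(g \<otimes> x \<otimes> inv g) \<otimes> (g \<otimes> y \<otimes> inv g) \<in> N"
        using x y g subgroup.m_closed[OF N] by (auto simp: C_def)
      moreover have "(g \<otimes> x \<otimes> inv g) \<otimes> (g \<otimes> y \<otimes> inv g) = g \<otimes> (x \<otimes> y) \<otimes> inv g"
        using x y g by (simp add: C_def m_assoc mult_inv_cancel)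
      ultimately show ?thesis by simp
    qed
    then show "x \<otimes> y \<in> C" using x y by (auto simp: C_def)
  qed
  have "C \<lhd> G"
  proof (rule normal_invI[OF sub])
    fix g x assume g: "g \<in> carrier G" and x: "x \<in> C"
    have xG: "x \<in> carrier G" using x by (simp add: C_def)
    have "h \<otimes> (g \<otimes> x \<otimes> inv g) \<otimes> inv h \<in> N" if h: "h \<in> carrier G" for h
    proof -
      have "(h \<otimes> g) \<otimes> x \<otimes> inv (h \<otimes> g) \<in> N" using x g h by (auto simp: C_def)
      then show ?thesis using xG g h by (simp add: inv_mult_group m_assoc)
    qed
    then show "g \<otimes> x \<otimes> inv g \<in> C" using xG g by (auto simp: C_def)
  qed
  moreover have "finite_index_subgroup G C"
  proof (rule finite_index_subgroupI[OF sub])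
    \<comment> \<open>The action of \<open>x\<close> on the cosets. Restricting the function to
      \<open>rcosets N\<close> makes it extensional, so that all values lie in a finite function
      space.\<close>
    let ?f = "\<lambda>x. \<lambda>A \<in> rcosets N. A #> x"
    have "A #> x \<in> rcosets N" if "A \<in> rcosets N" "x \<in> carrier G" for A x
      using that subgroup.subset[OF N] by (auto simp: RCOSETS_def coset_mult_assoc)
    then have "?f ` carrier G \<subseteq> rcosets N \<rightarrow>\<^sub>E rcosets N" by auto
    then show "finite (?f ` carrier G)"
      using fin by (meson finite_PiE finite_subset)
    fix x y assume x: "x \<in> carrier G" and y: "y \<in> carrier G" and eq: "?f x = ?f y"
    have "g \<otimes> (x \<otimes> inv y) \<otimes> inv g \<in> N" if g: "g \<in> carrier G" for g
    proof -
      have "N #> g \<in> rcosets N" using g subgroup.subset[OF N] by (auto simp: RCOSETS_def)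
      then have "N #> g #> x = N #> g #> y"
        using fun_cong[OF eq, of "N #> g"] by simp
      then have "N #> (g \<otimes> x) = N #> (g \<otimes> y)"
        using g x y subgroup.subset[OF N] by (simp add: coset_mult_assoc)
      then show ?thesis
        using g x y N by (simp add: r_coset_eq_iff inv_mult_group m_assoc)
    qed
    then show "x \<otimes> inv y \<in> C" using x y by (auto simp: C_def)
  qed
  moreover have "C \<subseteq> N"
  proof
    fix x assume "x \<in> C"
    then have "x \<in> carrier G" "\<one> \<otimes> x \<otimes> inv \<one> \<in> N" unfolding C_def by blast+
    then show "x \<in> N" by simp
  qed
  ultimately show thesis using that by blast
qed

text \<open>A basic neighbourhood of \<open>x\<close> is a coset of a finite-index subgroup, and
  passing to the normal core shrinks it to a coset of a normal one. Normality is what lets later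
  arguments conjugate and translate separating cosets.\<close>

lemma separable_in_iff:
  "separable_in G S \<longleftrightarrow> S \<subseteq> carrier G \<and>
     (\<forall>x \<in> carrier G - S. \<exists>N. N \<lhd> G \<and> finite_index_subgroup G N \<and> (\<forall>n \<in> N. n \<otimes> x \<notin> S))"
    (is "_ \<longleftrightarrow> _ \<and> ?R")
proof -
  let ?P = "\<lambda>C. \<exists>N. finite_index_subgroup G N \<and> C \<in> rcosets N"
  have "openin (profinite_topology G) (carrier G - S) \<longleftrightarrow>
          (\<forall>x \<in> carrier G - S. \<exists>C. ?P C \<and> x \<in> C \<and> C \<subseteq> carrier G - S)"
    by (subst openin_profinite_topology[OF is_group]) (simp add: arbitrary_union_of_alt)
  also have "\<dots> \<longleftrightarrow> ?R"
  proof (intro ball_cong refl iffI)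
    fix x assume x: "x \<in> carrier G - S"
    assume "\<exists>C. ?P C \<and> x \<in> C \<and> C \<subseteq> carrier G - S"
    then obtain C N where C: "finite_index_subgroup G N" "C \<in> rcosets N" "x \<in> C"
      "C \<subseteq> carrier G - S" by blast
    then have N: "subgroup N G" by (simp add: finite_index_subgroup_def)
    then have CN: "C = N #> x"
      using C(2,3) repr_independence by (auto simp: RCOSETS_def)
    obtain M where "M \<lhd> G" "finite_index_subgroup G M" "M \<subseteq> N"
      using finite_index_normal_core[OF C(1)] .
    moreover have "n \<otimes> x \<notin> S" if "n \<in> N" for n
      using that C(4) x subgroup.subset[OF N] rcosI[of n N x] unfolding CN by blast
    ultimately show "\<exists>N. N \<lhd> G \<and> finite_index_subgroup G N \<and> (\<forall>n \<in> N. n \<otimes> x \<notin> S)"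
      by blast
  next
    fix x assume x: "x \<in> carrier G - S"
    assume "\<exists>N. N \<lhd> G \<and> finite_index_subgroup G N \<and> (\<forall>n \<in> N. n \<otimes> x \<notin> S)"
    then obtain N where N: "finite_index_subgroup G N" "\<forall>n \<in> N. n \<otimes> x \<notin> S" by blast
    then have s: "subgroup N G" by (simp add: finite_index_subgroup_def)
    have "N #> x \<in> rcosets N" "x \<in> N #> x"
      using x s rcosetsI[OF subgroup.subset[OF s]] rcos_self by auto
    moreover have "N #> x \<subseteq> carrier G - S"
      using N(2) x subgroup.mem_carrier[OF s] by (auto simp: r_coset_def)
    ultimately show "\<exists>C. ?P C \<and> x \<in> C \<and> C \<subseteq> carrier G - S"
      using N(1) by blast
  qed
  finally show ?thesis
    by (simp add: separable_in_def closedin_def topspace_profinite_topology[OF is_group])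
qed

lemma separable_inE:
  assumes "separable_in G S" "x \<in> carrier G" "x \<notin> S"
  obtains N where "N \<lhd> G" "finite_index_subgroup G N" "\<And>n. n \<in> N \<Longrightarrow> n \<otimes> x \<notin> S"
proof -
  have "\<exists>N. N \<lhd> G \<and> finite_index_subgroup G N \<and> (\<forall>n \<in> N. n \<otimes> x \<notin> S)"
    using assms by (simp add: separable_in_iff)
  then show thesis using that by metis
qed

text \<open>The subgroup that separates \<open>inv a \<otimes> x \<otimes> inv b\<close> from
  \<open>S\<close> also separates \<open>x\<close> from the translate, because conjugation by
  \<open>inv a\<close> maps the normal subgroup \<open>N\<close> into itself.\<close>

lemma separable_in_translate:
  assumes S: "separable_in G S" and a: "a \<in> carrier G" and b: "b \<in> carrier G"
  shows "separable_in G ((\<lambda>s. a \<otimes> s \<otimes> b) ` S)"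
  unfolding separable_in_iff
proof (intro conjI ballI)
  have SG: "S \<subseteq> carrier G" using S by (simp add: separable_in_iff)
  then show "(\<lambda>s. a \<otimes> s \<otimes> b) ` S \<subseteq> carrier G" using a b by auto
  fix x assume x: "x \<in> carrier G - (\<lambda>s. a \<otimes> s \<otimes> b) ` S"
  define y where "y = inv a \<otimes> x \<otimes> inv b"
  have "x = a \<otimes> y \<otimes> b" using x a b by (simp add: y_def m_assoc mult_inv_cancel)
  then have "y \<in> carrier G" "y \<notin> S" using x a b by (auto simp: y_def)
  then obtain N where N: "N \<lhd> G" "finite_index_subgroup G N" "\<And>n. n \<in> N \<Longrightarrow> n \<otimes> y \<notin> S"
    using separable_inE[OF S] by metis
  have "n \<otimes> x \<noteq> a \<otimes> s \<otimes> b" if n: "n \<in> N" and s: "s \<in> S" for n s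
  proof
    assume eq: "n \<otimes> x = a \<otimes> s \<otimes> b"
    have nG: "n \<in> carrier G" using n subgroup.mem_carrier[OF normal_imp_subgroup[OF N(1)]] by simp
    have "inv a \<otimes> n \<otimes> a \<in> N"
      using normal_invE(2)[OF N(1), of "inv a" n] a n by simp
    moreover have "(inv a \<otimes> n \<otimes> a) \<otimes> y = inv a \<otimes> (n \<otimes> x) \<otimes> inv b"
      using nG x a b by (simp add: y_def m_assoc mult_inv_cancel)
    then have "(inv a \<otimes> n \<otimes> a) \<otimes> y = s"
      using eq s SG a b by (simp add: m_assoc subset_iff mult_inv_cancel)
    ultimately show False using N(3) s by metis
  qed
  then show "\<exists>N. N \<lhd> G \<and> finite_index_subgroup G N \<and>
      (\<forall>n\<in>N. n \<otimes> x \<notin> (\<lambda>s. a \<otimes> s \<otimes> b) ` S)"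
    using N(1,2) by blast
qed

section \<open>Transversals and Schreier's lemma\<close>

text \<open>\<open>H\<close> meets only finitely many cosets of \<open>N\<close>, and one
  representative is taken from each. The representatives are chosen in \<open>H\<close> itself, so
  that products and quotients with elements of a subgroup \<open>H\<close> stay there.\<close>

lemma finite_transversal:
  assumes N: "finite_index_subgroup G N" and H: "H \<subseteq> carrier G"
  obtains R where "finite R" "R \<subseteq> H" "\<And>h. h \<in> H \<Longrightarrow> \<exists>r \<in> R. h \<otimes> inv r \<in> N"
proof -
  have s: "subgroup N G" and fin: "finite (rcosets N)"
    using N by (auto simp: finite_index_subgroup_def)
  have "(\<lambda>h. N #> h) ` H \<subseteq> rcosets N"
    using H by (auto simp: RCOSETS_def)
  then have "finite ((\<lambda>h. N #> h) ` H)" using fin finite_subset by blast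
  then obtain R where R: "R \<subseteq> H" "finite R" "(\<lambda>h. N #> h) ` H = (\<lambda>h. N #> h) ` R"
    by (meson finite_subset_image subset_refl)
  have "\<exists>r \<in> R. h \<otimes> inv r \<in> N" if "h \<in> H" for h
  proof -
    have "N #> h \<in> (\<lambda>h. N #> h) ` R" using that R(3) by blast
    then obtain r where r: "r \<in> R" "N #> h = N #> r" by blast
    then have "h \<otimes> inv r \<in> N" using r_coset_eq_iff[OF s, of h r] that R(1) H by auto
    then show ?thesis using r(1) by blast
  qed
  then show thesis by (rule that[OF R(2,1)])
qed

(* Schreier's lemma: with D the subgroup generated by X and R a transversal, D R is stable under right
   multiplication by the generators of H, so it is all of H. *)
lemma fg_subgroup_Int_finite_index:
  assumes H: "fg_subgroup G H" and N: "finite_index_subgroup G N"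
  shows "fg_subgroup G (H \<inter> N)"
proof -
  obtain S where S: "finite S" "S \<subseteq> carrier G" "H = generate G S"
    using H by (auto simp: fg_subgroup_def)
  have sH: "subgroup H G" using S generate_is_subgroup by simp
  have sN: "subgroup N G" using N by (simp add: finite_index_subgroup_def)
  note HG = subgroup.mem_carrier[OF sH]
  obtain R where R: "finite R" "R \<subseteq> H" "\<And>h. h \<in> H \<Longrightarrow> \<exists>r \<in> R. h \<otimes> inv r \<in> N"
    using finite_transversal[OF N subgroup.subset[OF sH]] by metis
  \<comment> \<open>Closed under inverses, so that one argument covers both the \<open>incl\<close>
    and the \<open>inv\<close> case of the induction over \<open>generate\<close>.\<close>
  define S' where "S' = S \<union> (\<lambda>s. inv s) ` S"
  have S'H: "S' \<subseteq> H"
    using S(2,3) by (auto simp: S'_def intro: generate.incl generate.inv)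
  \<comment> \<open>The Schreier generators, together with the elements of \<open>R\<close> in
    \<open>N\<close>. The latter are included because the representative of the coset
    \<open>N\<close> need not be \<open>\<one>\<close>.\<close>
  define X where
    "X = N \<inter> (R \<union> (\<lambda>(r, s, r'). r \<otimes> s \<otimes> inv r') ` (R \<times> S' \<times> R))"
  have finX: "finite X" using R(1) S(1) by (simp add: X_def S'_def)
  have XH: "X \<subseteq> H \<inter> N"
    using R(2) S'H sH by (auto simp: X_def intro!: subgroup.m_closed subgroup.m_inv_closed)
  have XG: "X \<subseteq> carrier G" using XH HG by blast
  define D where "D = generate G X"
  have sD: "subgroup D G" using generate_is_subgroup[OF XG] by (simp add: D_def)
  note DG = subgroup.mem_carrier[OF sD]
  have step: "\<exists>d' \<in> D. \<exists>r' \<in> R. d \<otimes> r \<otimes> s = d' \<otimes> r'"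
    if d: "d \<in> D" and r: "r \<in> R" and s: "s \<in> S'" for d r s
  proof -
    have rs: "r \<in> H" "s \<in> H" using r s R(2) S'H by auto
    obtain r' where r': "r' \<in> R" "r \<otimes> s \<otimes> inv r' \<in> N"
      using R(3) subgroup.m_closed[OF sH rs] by blast
    then have "r \<otimes> s \<otimes> inv r' \<in> X" using r s by (force simp: X_def)
    then have "d \<otimes> (r \<otimes> s \<otimes> inv r') \<in> D"
      using d subgroup.m_closed[OF sD] generate.incl by (metis D_def)
    moreover have "d \<otimes> (r \<otimes> s \<otimes> inv r') \<otimes> r' = d \<otimes> r \<otimes> s"
      using DG[OF d] HG rs r'(1) R(2) by (simp add: m_assoc subset_iff)
    ultimately show ?thesis using r'(1) by metis
  qed
  \<comment> \<open>Quantified over all \<open>d\<close> and \<open>r\<close> within the induction: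
    for a product, the hypothesis for the second factor is applied to the pair that the first one
    produces.\<close>
  have inv_DR: "\<forall>d \<in> D. \<forall>r \<in> R. \<exists>d' \<in> D. \<exists>r' \<in> R. d \<otimes> r \<otimes> h = d' \<otimes> r'"
    if "h \<in> generate G S" for h
    using that
  proof (induction rule: generate.induct)
    case one
    then show ?case using DG HG R(2) by (metis m_closed r_one subsetD)
  next
    case (incl h)
    then show ?case using step by (auto simp: S'_def)
  next
    case (inv h)
    then show ?case using step by (auto simp: S'_def)
  next
    case (eng g h)
    have gh: "g \<in> carrier G" "h \<in> carrier G"
      using eng.hyps generate_in_carrier[OF S(2)] by auto
    show ?case
    proof (intro ballI)
      fix d r assume d: "d \<in> D" and r: "r \<in> R"
      then obtain d' r' where 1: "d' \<in> D" "r' \<in> R" "d \<otimes> r \<otimes> g = d' \<otimes> r'"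
        using eng.IH(1) by blast
      moreover have "d \<otimes> r \<otimes> (g \<otimes> h) = d \<otimes> r \<otimes> g \<otimes> h"
        using gh DG[OF d] HG r R(2) by (simp add: m_assoc subset_iff)
      ultimately show "\<exists>d' \<in> D. \<exists>r' \<in> R. d \<otimes> r \<otimes> (g \<otimes> h) = d' \<otimes> r'"
        using eng.IH(2) by metis
    qed
  qed
  have "H \<inter> N \<subseteq> D"
  proof
    fix l assume l: "l \<in> H \<inter> N"
    \<comment> \<open>\<open>r0\<close> represents the coset \<open>N\<close> and so lies in
      \<open>X\<close>. Writing \<open>\<one>\<close> as \<open>inv r0 \<otimes> r0\<close> exhibits
      it as an element of \<open>D R\<close>, the starting point for multiplying by
      \<open>l\<close>.\<close>
    obtain r0 where r0: "r0 \<in> R" "\<one> \<otimes> inv r0 \<in> N"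
      using R(3) subgroup.one_closed[OF sH] by blast
    have r0G: "r0 \<in> carrier G" using r0(1) R(2) HG by blast
    then have "inv r0 \<in> N" using r0(2) by simp
    then have "r0 \<in> N" using r0G subgroup.m_inv_closed[OF sN] by fastforce
    then have r0D: "inv r0 \<in> D"
      using r0(1) by (auto simp: D_def X_def intro: generate.inv)
    have lG: "l \<in> carrier G" using l HG by blast
    obtain d r where dr: "d \<in> D" "r \<in> R" "inv r0 \<otimes> r0 \<otimes> l = d \<otimes> r"
      using inv_DR[of l] l r0D r0(1) S(3) by blast
    then have leq: "l = d \<otimes> r" using lG r0G by simp
    have rG: "r \<in> carrier G" using dr(2) R(2) HG by blast
    \<comment> \<open>Both \<open>l\<close> and \<open>d\<close> lie in \<open>N\<close>, which
      forces \<open>r\<close> into \<open>R \<inter> N\<close>, hence into \<open>X\<close>; thus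
      both factors of \<open>l\<close> are in \<open>D\<close>.\<close>
    have "d \<in> N"
      using dr(1) XH sN generate_subgroup_incl[of X N] by (auto simp: D_def)
    moreover have "r = inv d \<otimes> l" using leq rG DG[OF dr(1)] by (simp add: m_assoc[symmetric])
    ultimately have "r \<in> N"
      using l sN by (simp add: subgroup.m_closed subgroup.m_inv_closed)
    then have "r \<in> D" using dr(2) by (auto simp: D_def X_def intro: generate.incl)
    then show "l \<in> D" using leq dr(1) subgroup.m_closed[OF sD] by simp
  qed
  moreover have "D \<subseteq> H \<inter> N"
    unfolding D_def by (rule generate_subgroup_incl[OF XH subgroups_Inter_pair[OF sH sN]])
  ultimately have "H \<inter> N = generate G X" by (auto simp: D_def)
  then show ?thesis using finX XG by (auto simp: fg_subgroup_def)
qed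

end

section \<open>Subgroups of finitely generated abelian groups\<close>

text \<open>Induction on the generators. With \<open>B\<close> generated by the old ones,
  \<open>T \<inter> B\<close> is finitely generated by induction, and the exponents of the new
  generator \<open>a\<close> that occur in \<open>T\<close> modulo \<open>B\<close> form a cyclic
  subgroup of the integers. One element of \<open>T\<close> realising a generating exponent
  completes the generating set.\<close>

lemma (in comm_group) fg_subgroup_of_generate:
  assumes "finite S" "S \<subseteq> carrier G" "subgroup T G" "T \<subseteq> generate G S"
  shows "fg_subgroup G T"
  using assms
proof (induction S arbitrary: T)
  case empty
  then have "T = generate G {}"
    using subgroup.one_closed generate_empty by fastforce
  then show ?case unfolding fg_subgroup_def by blast
next
  case (insert a S)
  have a: "a \<in> carrier G" and SG: "S \<subseteq> carrier G" using insert.prems by auto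
  define B where "B = generate G S"
  have sB: "subgroup B G" using SG generate_is_subgroup by (simp add: B_def)
  note BG = subgroup.mem_carrier[OF sB] and TG = subgroup.mem_carrier[OF insert.prems(2)]
  note sT = insert.prems(2)
  obtain X where X: "finite X" "X \<subseteq> carrier G" "T \<inter> B = generate G X"
    using insert.IH[OF SG subgroups_Inter_pair[OF sT sB]] by (auto simp: B_def fg_subgroup_def)
  have form: "\<exists>k::int. \<exists>b \<in> B. x = a [^] k \<otimes> b" if "x \<in> generate G (insert a S)" for x
    using that
  proof (induction rule: generate.induct)
    case one
    then show ?case using subgroup.one_closed[OF sB] by (intro exI[of _ 0] bexI[of _ \<one>]) auto
  next
    case (incl h)
    show ?case
    proof (cases "h = a")
      case True
      then show ?thesis using subgroup.one_closed[OF sB] a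
        by (intro exI[of _ 1] bexI[of _ \<one>]) (auto simp: int_pow_1)
    next
      case False
      then have "h \<in> B" using incl by (auto simp: B_def intro: generate.incl)
      then show ?thesis using BG by (intro exI[of _ 0] bexI[of _ h]) auto
    qed
  next
    case (inv h)
    show ?case
    proof (cases "h = a")
      case True
      then show ?thesis using subgroup.one_closed[OF sB] a
        by (intro exI[of _ "-1"] bexI[of _ \<one>]) (auto simp: int_pow_neg int_pow_1)
    next
      case False
      then have "inv h \<in> B" using inv by (auto simp: B_def intro: generate.inv)
      then show ?thesis using BG by (intro exI[of _ 0] bexI[of _ "inv h"]) auto
    qed
  next
    case (eng g h)
    then obtain k b l c where *: "b \<in> B" "c \<in> B" "g = a [^] (k::int) \<otimes> b" "h = a [^] (l::int) \<otimes> c"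
      by blast
    then have "g \<otimes> h = a [^] (k + l) \<otimes> (b \<otimes> c)"
      using BG a by (simp add: int_pow_mult m_ac)
    then show ?case using * subgroup.m_closed[OF sB] by blast
  qed
  define D where "D = {k::int. \<exists>b \<in> B. a [^] k \<otimes> b \<in> T}"
  \<comment> \<open>Dividing by the \<open>q\<close>-th power of the second element lowers the
    exponent of \<open>a\<close> by \<open>q * d\<close> without leaving \<open>T\<close>. So
    \<open>D\<close> is closed under remainders of division.\<close>
  have red: "k - q * d \<in> D" if k: "k \<in> D" and d: "d \<in> D" for k d q
  proof -
    obtain b c where bc: "b \<in> B" "c \<in> B" "a [^] k \<otimes> b \<in> T" "a [^] d \<otimes> c \<in> T"
      using k d by (auto simp: D_def)
    have "(a [^] k \<otimes> b) \<otimes> inv ((a [^] d \<otimes> c) [^] q) \<in> T"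
      by (intro subgroup.m_closed[OF sT] subgroup.m_inv_closed[OF sT] subgroup_int_pow_closed[OF sT] bc)
    moreover have "(a [^] k \<otimes> b) \<otimes> inv ((a [^] d \<otimes> c) [^] q)
        = a [^] (k - q * d) \<otimes> (b \<otimes> inv (c [^] q))"
      using bc(1,2) BG a
      by (simp add: int_pow_distrib int_pow_pow inv_mult m_ac int_pow_diff mult.commute)
    moreover have "b \<otimes> inv (c [^] q) \<in> B"
      by (intro subgroup.m_closed[OF sB] subgroup.m_inv_closed[OF sB] subgroup_int_pow_closed[OF sB] bc)
    ultimately show ?thesis by (auto simp: D_def)
  qed
  have "0 \<in> D"
    using subgroup.one_closed[OF sB] subgroup.one_closed[OF sT]
    by (auto simp: D_def intro!: bexI[of _ \<one>])
  \<comment> \<open>The generator of \<open>D\<close> is its least positive element, or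
    \<open>0\<close> if there is none.\<close>
  have "\<exists>d \<in> D. \<forall>k \<in> D. d dvd k"
  proof (cases "\<exists>n::nat. n > 0 \<and> int n \<in> D")
    case True
    define n where "n = (LEAST n::nat. n > 0 \<and> int n \<in> D)"
    have n: "n > 0" "int n \<in> D" using LeastI_ex[OF True] by (auto simp: n_def)
    have "int n dvd k" if "k \<in> D" for k
    proof (rule ccontr)
      assume "\<not> int n dvd k"
      then have "k mod int n > 0"
        using n(1) pos_mod_sign[of "int n" k] by (simp add: dvd_eq_mod_eq_0 le_less)
      moreover have "k mod int n < int n" using n(1) by simp
      moreover have "k mod int n \<in> D"
        using red[OF that n(2), of "k div int n"] by (simp add: minus_div_mult_eq_mod)
      ultimately show False
        using not_less_Least[of "nat (k mod int n)" "\<lambda>n. n > 0 \<and> int n \<in> D"]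
        by (simp add: n_def[symmetric] nat_less_iff)
    qed
    then show ?thesis using n(2) by blast
  next
    case False
    \<comment> \<open>If \<open>k\<close> were nonzero, then \<open>k\<close> or
      \<open>- k = k - 2 * k\<close> would be a positive element of \<open>D\<close>.\<close>
    have "k = 0" if k: "k \<in> D" for k
    proof (rule ccontr)
      assume "k \<noteq> 0"
      moreover have "- k \<in> D" using red[OF k k, of 2] by simp
      ultimately have "int (nat \<bar>k\<bar>) \<in> D" "nat \<bar>k\<bar> > 0" using k by (auto simp: abs_if)
      then show False using False by blast
    qed
    then show ?thesis using \<open>0 \<in> D\<close> by auto
  qed
  then obtain d c where d: "\<And>k. k \<in> D \<Longrightarrow> d dvd k" and c: "c \<in> B" "a [^] d \<otimes> c \<in> T"
    by (auto simp: D_def)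
  define t where "t = a [^] d \<otimes> c"
  have tT: "t \<in> T" using c by (simp add: t_def)
  have XT: "insert t X \<subseteq> T" using tT X(3) by (auto intro: generate.incl)
  have sX: "subgroup (generate G (insert t X)) G"
    using XT TG generate_is_subgroup[of "insert t X"] by blast
  have "T \<subseteq> generate G (insert t X)"
  proof
    fix x assume x: "x \<in> T"
    then obtain k b where kb: "b \<in> B" "x = a [^] (k::int) \<otimes> b"
      using form insert.prems(3) by blast
    then have "k \<in> D" using x by (auto simp: D_def)
    then obtain q where q: "k = d * q" using d by (auto elim: dvdE)
    \<comment> \<open>The exponent of \<open>a\<close> in \<open>x\<close> is \<open>d * q\<close>,
      so dividing by the \<open>q\<close>-th power of \<open>t\<close> cancels \<open>a\<close>
      entirely and leaves an element of \<open>T \<inter> B\<close>.\<close>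
    have "x \<otimes> inv (t [^] q) = b \<otimes> inv (c [^] q)"
      using kb c(1) BG a
      by (simp add: t_def q int_pow_distrib int_pow_pow inv_mult m_ac mult_inv_cancel)
    moreover have "b \<otimes> inv (c [^] q) \<in> B"
      by (intro subgroup.m_closed[OF sB] subgroup.m_inv_closed[OF sB] subgroup_int_pow_closed[OF sB] kb c)
    moreover have "x \<otimes> inv (t [^] q) \<in> T"
      by (intro subgroup.m_closed[OF sT] subgroup.m_inv_closed[OF sT] subgroup_int_pow_closed[OF sT] x tT)
    ultimately have "x \<otimes> inv (t [^] q) \<in> generate G X" using X(3) by auto
    then have "x \<otimes> inv (t [^] q) \<in> generate G (insert t X)"
      using mono_generate[of X "insert t X"] by blast
    moreover have "t [^] q \<in> generate G (insert t X)"
      by (intro subgroup_int_pow_closed[OF sX] generate.incl) simp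
    ultimately have "x \<otimes> inv (t [^] q) \<otimes> t [^] q \<in> generate G (insert t X)"
      using subgroup.m_closed[OF sX] by blast
    then show "x \<in> generate G (insert t X)"
      using TG[OF x] TG[OF tT] by (simp add: m_assoc)
  qed
  moreover have "generate G (insert t X) \<subseteq> T"
    using generate_subgroup_incl[OF XT sT] .
  ultimately show ?case
    using X(1) XT TG unfolding fg_subgroup_def
    by (intro exI[of _ "insert t X"]) auto
qed

section \<open>Images and preimages under a homomorphism\<close>

context group_hom
begin

lemma fg_subgroup_image:
  assumes "fg_subgroup G K"
  shows "fg_subgroup H (h ` K)"
proof -
  obtain S where S: "finite S" "S \<subseteq> carrier G" "K = generate G S"
    using assms by (auto simp: fg_subgroup_def)
  then have "h ` K = generate H (h ` S)" "h ` S \<subseteq> carrier H"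
    by (auto simp: generate_img)
  with S(1) show ?thesis unfolding fg_subgroup_def by blast
qed

text \<open>The coset of \<open>M\<close> containing \<open>h x\<close> determines the coset of
  \<open>x\<close> modulo the preimage, so pulling back does not increase the index.\<close>

lemma finite_index_normal_vimage:
  assumes M: "M \<lhd> H" "finite_index_subgroup H M"
  shows "{x \<in> carrier G. h x \<in> M} \<lhd> G" "finite_index_subgroup G {x \<in> carrier G. h x \<in> M}"
proof -
  have sM: "subgroup M H" and fin: "finite (rcosets\<^bsub>H\<^esub> M)"
    using M(2) by (auto simp: finite_index_subgroup_def)
  let ?V = "{x \<in> carrier G. h x \<in> M}"
  have sV: "subgroup ?V G"
    using sM subgroup.one_closed[OF sM] G.one_closed hom_one
    by (intro G.subgroupI) (auto simp: subgroup.m_closed subgroup.m_inv_closed simp del: G.one_closed)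
  show "?V \<lhd> G"
    using H.normal_invE(2)[OF M(1)] by (intro G.normal_invI[OF sV]) auto
  show "finite_index_subgroup G ?V"
  proof (rule G.finite_index_subgroupI[OF sV])
    let ?f = "\<lambda>x. M #>\<^bsub>H\<^esub> h x"
    have "?f ` carrier G \<subseteq> rcosets\<^bsub>H\<^esub> M"
      using H.rcosetsI[OF subgroup.subset[OF sM]] by auto
    then show "finite (?f ` carrier G)" using fin finite_subset by blast
    fix x y assume "x \<in> carrier G" "y \<in> carrier G" "?f x = ?f y"
    then show "x \<otimes>\<^bsub>G\<^esub> inv\<^bsub>G\<^esub> y \<in> ?V"
      using H.r_coset_eq_iff[OF sM] by auto
  qed
qed

end

section \<open>Double cosets, the centre and the two implications\<close>

text \<open>If \<open>a \<otimes> b\<close> is central, then \<open>a\<close> and \<open>b\<close>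
  commute, so its inverse is \<open>inv a \<otimes> inv b\<close>. If \<open>c \<otimes> d\<close>
  is central, it can be moved past \<open>b\<close>, turning \<open>a b c d\<close> into
  \<open>(a c) (d b)\<close>.\<close>

lemma (in group) double_coset_Int_centre_subgroup:
  assumes A: "subgroup A G" and B: "subgroup B G"
    and C: "subgroup C G" "C \<subseteq> group_centre G"
  shows "subgroup ((A <#> B) \<inter> C) G"
proof (rule subgroupI)
  show "(A <#> B) \<inter> C \<subseteq> carrier G" using subgroup.subset[OF C(1)] by blast
  have "\<one> \<otimes> \<one> \<in> A <#> B"
    using subgroup.one_closed[OF A] subgroup.one_closed[OF B] unfolding set_mult_def by blast
  then show "(A <#> B) \<inter> C \<noteq> {}" using subgroup.one_closed[OF C(1)] by auto
next
  note AG = subgroup.mem_carrier[OF A] and BG = subgroup.mem_carrier[OF B]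
  have comm: "z \<otimes> x = x \<otimes> z" if "z \<in> C" "x \<in> carrier G" for z x
    using C(2) that by (auto simp: group_centre_def)
  {
    fix z assume z: "z \<in> (A <#> B) \<inter> C"
    then obtain a b where ab: "a \<in> A" "b \<in> B" "z = a \<otimes> b" by (auto simp: set_mult_def)
    have zG: "z \<in> carrier G" using z subgroup.mem_carrier[OF C(1)] by blast
    have "z \<otimes> inv a = inv a \<otimes> z" using comm[of z "inv a"] z AG ab(1) by auto
    then have "inv z = inv a \<otimes> inv b"
      using ab AG BG zG
      by (metis inv_mult_group inv_closed inv_inv inv_solve_right' m_assoc m_closed
          mult_inv_cancel(2))
    then have "inv z \<in> A <#> B"
      using ab subgroup.m_inv_closed[OF A] subgroup.m_inv_closed[OF B]
      by (auto simp: set_mult_def)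
    then show "inv z \<in> (A <#> B) \<inter> C"
      using z subgroup.m_inv_closed[OF C(1)] by blast
  }
  fix z w assume z: "z \<in> (A <#> B) \<inter> C" and w: "w \<in> (A <#> B) \<inter> C"
  then obtain a b c d where ab: "a \<in> A" "b \<in> B" "z = a \<otimes> b" "c \<in> A" "d \<in> B" "w = c \<otimes> d"
    by (auto simp: set_mult_def)
  have wG: "w \<in> carrier G" using w subgroup.mem_carrier[OF C(1)] by blast
  have "z \<otimes> w = a \<otimes> (b \<otimes> w)" using ab AG BG by (simp add: m_assoc)
  also have "\<dots> = a \<otimes> (w \<otimes> b)" using comm[of w b] w ab BG by simp
  also have "\<dots> = (a \<otimes> c) \<otimes> (d \<otimes> b)" using ab AG BG by (simp add: m_assoc)
  finally have "z \<otimes> w \<in> A <#> B"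
    using ab subgroup.m_closed[OF A, of a c] subgroup.m_closed[OF B, of d b]
    unfolding set_mult_def by blast
  then show "z \<otimes> w \<in> (A <#> B) \<inter> C"
    using z w subgroup.m_closed[OF C(1)] by blast
qed

text \<open>The trivial subgroup is finitely generated, so it can serve as the second factor of a
  double coset.\<close>

lemma double_coset_separable_imp_subgroup_separable:
  assumes "double_coset_separable G"
  shows "subgroup_separable G"
proof -
  interpret group G using assms by (simp add: double_coset_separable_def)
  have triv: "fg_subgroup G {\<one>\<^bsub>G\<^esub>}"
    using generate_empty unfolding fg_subgroup_def by (intro exI[of _ "{}"]) simp
  have "separable_in G H" if H: "fg_subgroup G H" for H
  proof -
    have "H \<subseteq> carrier G" using H generate_incl by (auto simp: fg_subgroup_def)
    then have "H <#>\<^bsub>G\<^esub> {\<one>\<^bsub>G\<^esub>} = H" by (force simp: set_mult_def)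
    then show ?thesis using assms H triv unfolding double_coset_separable_def by metis
  qed
  then show ?thesis using is_group by (simp add: subgroup_separable_def)
qed

text \<open>The hard implication with the central subgroup taken to be the kernel of
  \<open>h\<close>. Finite generation of that subgroup enters through \<open>noeth\<close>, which
  makes the subgroup \<open>T\<close> below finitely generated and hence separable.\<close>

lemma (in group_hom) double_coset_separable_central_kernel:
  assumes Q: "double_coset_separable H" and G: "subgroup_separable G"
    and central: "kernel G H h \<subseteq> group_centre G"
    and noeth: "\<And>T. subgroup T G \<Longrightarrow> T \<subseteq> kernel G H h \<Longrightarrow> fg_subgroup G T"
  shows "double_coset_separable G"
  unfolding double_coset_separable_def
proof (intro conjI allI impI G.is_group)
  fix A B assume fgA: "fg_subgroup G A" and fgB: "fg_subgroup G B"
  have A: "subgroup A G" and B: "subgroup B G"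
    using fgA fgB G.generate_is_subgroup by (auto simp: fg_subgroup_def)
  note AG = subgroup.mem_carrier[OF A] and BG = subgroup.mem_carrier[OF B]
  define S where "S = A <#>\<^bsub>G\<^esub> B"
  have SI: "a \<otimes>\<^bsub>G\<^esub> b \<in> S" if "a \<in> A" "b \<in> B" for a b
    using that by (auto simp: S_def set_mult_def)
  have SE: "\<exists>a \<in> A. \<exists>b \<in> B. x = a \<otimes>\<^bsub>G\<^esub> b" if "x \<in> S" for x
    using that by (auto simp: S_def set_mult_def)
  have SG: "S \<subseteq> carrier G" using SE AG BG by fastforce
  have comm: "z \<otimes>\<^bsub>G\<^esub> x = x \<otimes>\<^bsub>G\<^esub> z" if "z \<in> kernel G H h" "x \<in> carrier G" for z x
    using central that by (auto simp: group_centre_def)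
  have kernel_case: "\<exists>N. N \<lhd> G \<and> finite_index_subgroup G N \<and> (\<forall>n \<in> N. n \<otimes>\<^bsub>G\<^esub> z \<notin> S)"
    if z: "z \<in> kernel G H h" and zS: "z \<notin> S" for z
  proof -
    have zG: "z \<in> carrier G" and hz: "h z = \<one>\<^bsub>H\<^esub>" using z by (auto simp: kernel_def)
    define T where "T = S \<inter> kernel G H h"
    have sT: "subgroup T G"
      unfolding T_def S_def
      by (rule G.double_coset_Int_centre_subgroup[OF A B subgroup_kernel central])
    then have sepT: "separable_in G T"
      using noeth[OF sT] G by (auto simp: T_def subgroup_separable_def)
    then obtain N where N: "N \<lhd> G" "finite_index_subgroup G N" "\<And>n. n \<in> N \<Longrightarrow> n \<otimes>\<^bsub>G\<^esub> z \<notin> T"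
      using G.separable_inE[OF sepT zG] zS unfolding T_def by (metis IntD1)
    have sN: "subgroup N G" using N(1) by (rule normal_imp_subgroup)
    note NG = subgroup.mem_carrier[OF sN]
    obtain RA where RA: "finite RA" "RA \<subseteq> A" "\<And>a. a \<in> A \<Longrightarrow> \<exists>r \<in> RA. a \<otimes>\<^bsub>G\<^esub> inv\<^bsub>G\<^esub> r \<in> N"
      using G.finite_transversal[OF N(2) subgroup.subset[OF A]] by metis
    obtain RB where RB: "finite RB" "RB \<subseteq> B" "\<And>b. b \<in> B \<Longrightarrow> \<exists>r \<in> RB. b \<otimes>\<^bsub>G\<^esub> inv\<^bsub>G\<^esub> r \<in> N"
      using G.finite_transversal[OF N(2) subgroup.subset[OF B]] by metis
    \<comment> \<open>The pairs with \<open>r s\<close> in the coset \<open>N z\<close>. Since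
      \<open>N\<close> is normal, \<open>r (A \<inter> N) (B \<inter> N) s\<close> lies in the coset
      of \<open>r s\<close>, so these pairs index exactly the blocks that make up
      \<open>S \<inter> N z\<close>.\<close>
    define P where "P = {(r, s). r \<in> RA \<and> s \<in> RB \<and> (r \<otimes>\<^bsub>G\<^esub> s) \<otimes>\<^bsub>G\<^esub> inv\<^bsub>G\<^esub> z \<in> N}"
    have finP: "finite P"
      by (rule finite_subset[of _ "RA \<times> RB"]) (use RA RB in \<open>auto simp: P_def\<close>)
    define D where "D = h ` (A \<inter> N) <#>\<^bsub>H\<^esub> h ` (B \<inter> N)"
    have sepD: "separable_in H D"
      using Q fgA fgB N(2) G.fg_subgroup_Int_finite_index fg_subgroup_image
      by (simp add: D_def double_coset_separable_def)
    \<comment> \<open>The image of \<open>S \<inter> N z\<close> under \<open>h\<close>. It is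
      closed, being a finite union of translates of the separable set \<open>D\<close>.\<close>
    define C where "C = (\<Union>(r, s) \<in> P. (\<lambda>d. h r \<otimes>\<^bsub>H\<^esub> d \<otimes>\<^bsub>H\<^esub> h s) ` D)"
    have "separable_in H ((\<lambda>d. h r \<otimes>\<^bsub>H\<^esub> d \<otimes>\<^bsub>H\<^esub> h s) ` D)" if "(r, s) \<in> P" for r s
      using that RA(2) RB(2) AG BG
      by (intro H.separable_in_translate[OF sepD] hom_closed) (auto simp: P_def)
    then have sepC: "separable_in H C"
      using finP unfolding C_def separable_in_def by (intro closedin_Union) auto
    \<comment> \<open>Otherwise some element of \<open>S \<inter> N z\<close> lies in the kernel,
      hence in \<open>T\<close>, although the coset \<open>N z\<close> was chosen to miss
      \<open>T\<close>.\<close>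
    have "\<one>\<^bsub>H\<^esub> \<notin> C"
    proof
      assume "\<one>\<^bsub>H\<^esub> \<in> C"
      then obtain r s a b where rs: "(r, s) \<in> P" and a: "a \<in> A" "a \<in> N" and b: "b \<in> B" "b \<in> N"
        and eq: "\<one>\<^bsub>H\<^esub> = h r \<otimes>\<^bsub>H\<^esub> (h a \<otimes>\<^bsub>H\<^esub> h b) \<otimes>\<^bsub>H\<^esub> h s"
        by (auto simp: C_def D_def set_mult_def)
      have r: "r \<in> A" "r \<in> carrier G" and s: "s \<in> B" "s \<in> carrier G"
        and rsN: "(r \<otimes>\<^bsub>G\<^esub> s) \<otimes>\<^bsub>G\<^esub> inv\<^bsub>G\<^esub> z \<in> N"
        using rs RA(2) RB(2) AG BG by (auto simp: P_def)
      define x where "x = (r \<otimes>\<^bsub>G\<^esub> a) \<otimes>\<^bsub>G\<^esub> (b \<otimes>\<^bsub>G\<^esub> s)"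
      have xS: "x \<in> S"
        unfolding x_def by (intro SI subgroup.m_closed[OF A] subgroup.m_closed[OF B] r a b s)
      have xG: "x \<in> carrier G" using xS SG by blast
      have "h x = \<one>\<^bsub>H\<^esub>" using eq r s a(2) b(2) NG by (simp add: x_def H.m_assoc)
      then have "x \<in> T" using xS xG by (simp add: T_def kernel_def)
      have "r \<otimes>\<^bsub>G\<^esub> (a \<otimes>\<^bsub>G\<^esub> b) \<otimes>\<^bsub>G\<^esub> inv\<^bsub>G\<^esub> r \<in> N"
        by (intro G.normal_invE(2)[OF N(1)] r subgroup.m_closed[OF sN] a b)
      then have "(r \<otimes>\<^bsub>G\<^esub> (a \<otimes>\<^bsub>G\<^esub> b) \<otimes>\<^bsub>G\<^esub> inv\<^bsub>G\<^esub> r) \<otimes>\<^bsub>G\<^esub> ((r \<otimes>\<^bsub>G\<^esub> s) \<otimes>\<^bsub>G\<^esub> inv\<^bsub>G\<^esub> z) \<in> N"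
        using rsN subgroup.m_closed[OF sN] by blast
      moreover have "(r \<otimes>\<^bsub>G\<^esub> (a \<otimes>\<^bsub>G\<^esub> b) \<otimes>\<^bsub>G\<^esub> inv\<^bsub>G\<^esub> r) \<otimes>\<^bsub>G\<^esub> ((r \<otimes>\<^bsub>G\<^esub> s) \<otimes>\<^bsub>G\<^esub> inv\<^bsub>G\<^esub> z)
          = x \<otimes>\<^bsub>G\<^esub> inv\<^bsub>G\<^esub> z"
        using r(2) s(2) NG[OF a(2)] NG[OF b(2)] zG
        by (simp add: x_def G.m_assoc G.mult_inv_cancel)
      ultimately have "x \<otimes>\<^bsub>G\<^esub> inv\<^bsub>G\<^esub> z \<in> N" by simp
      from N(3)[OF this] \<open>x \<in> T\<close> show False
        using xG zG by (simp add: G.m_assoc)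
    qed
    then obtain M where M: "M \<lhd> H" "finite_index_subgroup H M" "\<And>m. m \<in> M \<Longrightarrow> m \<otimes>\<^bsub>H\<^esub> \<one>\<^bsub>H\<^esub> \<notin> C"
      using H.separable_inE[OF sepC H.one_closed] by metis
    \<comment> \<open>Were \<open>n \<otimes> z\<close> in \<open>S\<close> for some
      \<open>n\<close> in \<open>N'\<close>, membership in \<open>N\<close> would put
      \<open>h (n \<otimes> z)\<close> in \<open>C\<close>, while this value equals
      \<open>h n\<close>, an element of \<open>M\<close>, and \<open>M\<close> misses
      \<open>C\<close>.\<close>
    define N' where "N' = N \<inter> {x \<in> carrier G. h x \<in> M}"
    have "N' \<lhd> G" "finite_index_subgroup G N'"
      unfolding N'_def
      using finite_index_normal_vimage[OF M(1,2)] N(1,2)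
      by (auto intro: G.normal_subgroup_intersect finite_index_subgroup_Int[OF G.is_group])
    moreover have "n \<otimes>\<^bsub>G\<^esub> z \<notin> S" if n: "n \<in> N'" for n
    proof
      assume "n \<otimes>\<^bsub>G\<^esub> z \<in> S"
      then obtain a b where ab: "a \<in> A" "b \<in> B" "n \<otimes>\<^bsub>G\<^esub> z = a \<otimes>\<^bsub>G\<^esub> b" using SE by blast
      have nN: "n \<in> N" and nG: "n \<in> carrier G" and nM: "h n \<in> M" using n by (auto simp: N'_def)
      obtain r where r: "r \<in> RA" "a \<otimes>\<^bsub>G\<^esub> inv\<^bsub>G\<^esub> r \<in> N" using RA(3) ab(1) by blast
      obtain s where s: "s \<in> RB" "b \<otimes>\<^bsub>G\<^esub> inv\<^bsub>G\<^esub> s \<in> N" using RB(3) ab(2) by blast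
      have G: "a \<in> carrier G" "b \<in> carrier G" "r \<in> carrier G" "s \<in> carrier G"
        and rA: "r \<in> A" and sB: "s \<in> B"
        using ab r(1) s(1) RA(2) RB(2) AG BG by auto
      define a' where "a' = inv\<^bsub>G\<^esub> r \<otimes>\<^bsub>G\<^esub> a"
      define b' where "b' = b \<otimes>\<^bsub>G\<^esub> inv\<^bsub>G\<^esub> s"
      \<comment> \<open>The transversal puts \<open>a\<close> times the inverse of \<open>r\<close>
        in \<open>N\<close>; conjugation moves that inverse to the left, where the block
        decomposition needs it.\<close>
      have "inv\<^bsub>G\<^esub> r \<otimes>\<^bsub>G\<^esub> (a \<otimes>\<^bsub>G\<^esub> inv\<^bsub>G\<^esub> r) \<otimes>\<^bsub>G\<^esub> inv\<^bsub>G\<^esub> (inv\<^bsub>G\<^esub> r) \<in> N"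
        using G r(2) by (intro G.normal_invE(2)[OF N(1)]) auto
      then have a'N: "a' \<in> N" using G by (simp add: a'_def G.m_assoc)
      have a'A: "a' \<in> A"
        unfolding a'_def by (intro subgroup.m_closed[OF A] subgroup.m_inv_closed[OF A] rA ab)
      have b'N: "b' \<in> N" using s(2) by (simp add: b'_def)
      have b'B: "b' \<in> B"
        unfolding b'_def by (intro subgroup.m_closed[OF B] subgroup.m_inv_closed[OF B] sB ab)
      have G': "a' \<in> carrier G" "b' \<in> carrier G" using a'N b'N NG by auto
      have nz: "n \<otimes>\<^bsub>G\<^esub> z = r \<otimes>\<^bsub>G\<^esub> (a' \<otimes>\<^bsub>G\<^esub> b') \<otimes>\<^bsub>G\<^esub> s"
        using G by (simp add: ab(3) a'_def b'_def G.m_assoc G.mult_inv_cancel)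
      have "inv\<^bsub>G\<^esub> (r \<otimes>\<^bsub>G\<^esub> (a' \<otimes>\<^bsub>G\<^esub> b') \<otimes>\<^bsub>G\<^esub> inv\<^bsub>G\<^esub> r) \<otimes>\<^bsub>G\<^esub> n \<in> N"
        using a'N b'N nN G
        by (intro subgroup.m_closed[OF sN] subgroup.m_inv_closed[OF sN] G.normal_invE(2)[OF N(1)])
      moreover have "n = r \<otimes>\<^bsub>G\<^esub> (a' \<otimes>\<^bsub>G\<^esub> b') \<otimes>\<^bsub>G\<^esub> s \<otimes>\<^bsub>G\<^esub> inv\<^bsub>G\<^esub> z"
        using nz nG zG G G' by (metis G.inv_solve_right G.m_closed)
      then have "inv\<^bsub>G\<^esub> (r \<otimes>\<^bsub>G\<^esub> (a' \<otimes>\<^bsub>G\<^esub> b') \<otimes>\<^bsub>G\<^esub> inv\<^bsub>G\<^esub> r) \<otimes>\<^bsub>G\<^esub> n = r \<otimes>\<^bsub>G\<^esub> s \<otimes>\<^bsub>G\<^esub> inv\<^bsub>G\<^esub> z"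
        using zG G G' by (simp add: G.inv_mult_group G.m_assoc G.mult_inv_cancel)
      ultimately have "(r, s) \<in> P" using r(1) s(1) by (simp add: P_def)
      moreover have "h a' \<otimes>\<^bsub>H\<^esub> h b' \<in> D"
        using a'A a'N b'B b'N by (auto simp: D_def set_mult_def)
      ultimately have "h r \<otimes>\<^bsub>H\<^esub> (h a' \<otimes>\<^bsub>H\<^esub> h b') \<otimes>\<^bsub>H\<^esub> h s \<in> C"
        unfolding C_def by blast
      moreover have "h r \<otimes>\<^bsub>H\<^esub> (h a' \<otimes>\<^bsub>H\<^esub> h b') \<otimes>\<^bsub>H\<^esub> h s = h (n \<otimes>\<^bsub>G\<^esub> z)"
        using G G' by (simp add: nz)
      moreover have "h (n \<otimes>\<^bsub>G\<^esub> z) = h n \<otimes>\<^bsub>H\<^esub> \<one>\<^bsub>H\<^esub>" using nG zG hz by simp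
      ultimately show False using M(3)[OF nM] by simp
    qed
    ultimately show ?thesis by blast
  qed
  have "\<exists>N. N \<lhd> G \<and> finite_index_subgroup G N \<and> (\<forall>n \<in> N. n \<otimes>\<^bsub>G\<^esub> g \<notin> S)"
    if g: "g \<in> carrier G" and gS: "g \<notin> S" for g
  proof (cases "h g \<in> h ` A <#>\<^bsub>H\<^esub> h ` B")
    case True
    then obtain a b where ab: "a \<in> A" "b \<in> B" "h g = h a \<otimes>\<^bsub>H\<^esub> h b"
      by (auto simp: set_mult_def)
    have G: "a \<in> carrier G" "b \<in> carrier G" using ab AG BG by auto
    \<comment> \<open>The discrepancy between \<open>g\<close> and \<open>a b\<close>; it lies in
      the kernel because both have the same image. As \<open>z\<close> is central,
      \<open>g = a z b\<close>, so \<open>z\<close> in \<open>S\<close> would imply \<open>g\<close>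
      in \<open>S\<close>.\<close>
    define z where "z = inv\<^bsub>G\<^esub> (a \<otimes>\<^bsub>G\<^esub> b) \<otimes>\<^bsub>G\<^esub> g"
    have gz: "g = a \<otimes>\<^bsub>G\<^esub> b \<otimes>\<^bsub>G\<^esub> z" and zG: "z \<in> carrier G"
      using G g by (simp_all add: z_def G.mult_inv_cancel)
    have zK: "z \<in> kernel G H h"
      using G g ab(3) by (simp add: kernel_def z_def)
    have "z \<notin> S"
    proof
      assume "z \<in> S"
      then obtain c d where cd: "c \<in> A" "d \<in> B" "z = c \<otimes>\<^bsub>G\<^esub> d" using SE by blast
      have "g = a \<otimes>\<^bsub>G\<^esub> (z \<otimes>\<^bsub>G\<^esub> b)" using gz G zG comm[OF zK, of b] by (simp add: G.m_assoc)
      also have "\<dots> = (a \<otimes>\<^bsub>G\<^esub> c) \<otimes>\<^bsub>G\<^esub> (d \<otimes>\<^bsub>G\<^esub> b)"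
        using cd G AG BG by (simp add: G.m_assoc)
      finally show False
        using gS SI subgroup.m_closed[OF A] subgroup.m_closed[OF B] ab cd by metis
    qed
    then obtain N where N: "N \<lhd> G" "finite_index_subgroup G N" "\<And>n. n \<in> N \<Longrightarrow> n \<otimes>\<^bsub>G\<^esub> z \<notin> S"
      using kernel_case[OF zK] by blast
    have "n \<otimes>\<^bsub>G\<^esub> g \<notin> S" if n: "n \<in> N" for n
    proof
      assume "n \<otimes>\<^bsub>G\<^esub> g \<in> S"
      then obtain c d where cd: "c \<in> A" "d \<in> B" "n \<otimes>\<^bsub>G\<^esub> g = c \<otimes>\<^bsub>G\<^esub> d" using SE by blast
      have nG: "n \<in> carrier G" using n subgroup.mem_carrier[OF normal_imp_subgroup[OF N(1)]] by simp
      \<comment> \<open>Multiplying by \<open>inv a\<close> on the left and \<open>inv b\<close> on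
        the right preserves \<open>S\<close> and carries \<open>n g\<close> to \<open>m z\<close>,
        so the subgroup that works for \<open>z\<close> works for \<open>g\<close>.\<close>
      define m where "m = inv\<^bsub>G\<^esub> a \<otimes>\<^bsub>G\<^esub> n \<otimes>\<^bsub>G\<^esub> a"
      have mN: "m \<in> N" using G.normal_invE(2)[OF N(1), of "inv\<^bsub>G\<^esub> a" n] G n by (simp add: m_def)
      have "m \<otimes>\<^bsub>G\<^esub> z = inv\<^bsub>G\<^esub> a \<otimes>\<^bsub>G\<^esub> (n \<otimes>\<^bsub>G\<^esub> g) \<otimes>\<^bsub>G\<^esub> inv\<^bsub>G\<^esub> b"
      proof -
        have "z \<otimes>\<^bsub>G\<^esub> inv\<^bsub>G\<^esub> b = inv\<^bsub>G\<^esub> b \<otimes>\<^bsub>G\<^esub> z" using comm[OF zK] G by simp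
        then show ?thesis
          using nG G zG by (simp add: m_def gz G.m_assoc G.mult_inv_cancel)
      qed
      also have "\<dots> = (inv\<^bsub>G\<^esub> a \<otimes>\<^bsub>G\<^esub> c) \<otimes>\<^bsub>G\<^esub> (d \<otimes>\<^bsub>G\<^esub> inv\<^bsub>G\<^esub> b)"
        using cd G AG BG by (simp add: G.m_assoc)
      also have "\<dots> \<in> S"
        by (intro SI subgroup.m_closed[OF A] subgroup.m_closed[OF B]
            subgroup.m_inv_closed[OF A] subgroup.m_inv_closed[OF B] ab cd)
      finally show False using N(3)[OF mN] by blast
    qed
    then show ?thesis using N(1,2) by blast
  next
    case False
    \<comment> \<open>Here the quotient already separates, and the separating subgroup is pulled
      back along \<open>h\<close>.\<close>
    have "separable_in H (h ` A <#>\<^bsub>H\<^esub> h ` B)"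
      using Q fgA fgB fg_subgroup_image by (simp add: double_coset_separable_def)
    then obtain M where M: "M \<lhd> H" "finite_index_subgroup H M"
      "\<And>m. m \<in> M \<Longrightarrow> m \<otimes>\<^bsub>H\<^esub> h g \<notin> h ` A <#>\<^bsub>H\<^esub> h ` B"
      using H.separable_inE[OF _ hom_closed[OF g] False] by metis
    have "n \<otimes>\<^bsub>G\<^esub> g \<notin> S" if n: "n \<in> carrier G" "h n \<in> M" for n
    proof
      assume "n \<otimes>\<^bsub>G\<^esub> g \<in> S"
      then obtain a b where ab: "a \<in> A" "b \<in> B" "n \<otimes>\<^bsub>G\<^esub> g = a \<otimes>\<^bsub>G\<^esub> b" using SE by blast
      have "h n \<otimes>\<^bsub>H\<^esub> h g = h a \<otimes>\<^bsub>H\<^esub> h b"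
        using arg_cong[OF ab(3), of h] n g AG[OF ab(1)] BG[OF ab(2)] by simp
      then show False using M(3)[OF n(2)] ab by (auto simp: set_mult_def)
    qed
    then show ?thesis using finite_index_normal_vimage[OF M(1,2)] by blast
  qed
  then show "separable_in G (A <#>\<^bsub>G\<^esub> B)"
    using SG unfolding G.separable_in_iff S_def by blast
qed

section \<open>Transfer to the given central extension\<close>

theorem theorem1p3:
  fixes Z :: "('z, 'c) monoid_scheme"
    and G :: "('g, 'd) monoid_scheme"
    and Q :: "('q, 'e) monoid_scheme"
    and i :: "'z \<Rightarrow> 'g"
    and p :: "'g \<Rightarrow> 'q"
  assumes "double_coset_separable Q"
    and "fg_group Z"
    and "central_extension Z G Q i p"
  shows "double_coset_separable G \<longleftrightarrow> subgroup_separable G"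
proof
  show "subgroup_separable G" if "double_coset_separable G"
    using that by (rule double_coset_separable_imp_subgroup_separable)
next
  assume sepG: "subgroup_separable G"
  have gZ: "group Z" and gG: "group G" and gQ: "group Q"
    and i: "i \<in> hom Z G" "inj_on i (carrier Z)" and p: "p \<in> hom G Q"
    and ker: "i ` carrier Z = kernel G Q p" and cen: "i ` carrier Z \<subseteq> group_centre G"
    using assms(3) by (auto simp: central_extension_def mon_def epi_def)
  interpret i: group_hom Z G i
    using gZ gG i(1) by (simp add: group_hom_def group_hom_axioms_def)
  interpret p: group_hom G Q p
    using gG gQ p by (simp add: group_hom_def group_hom_axioms_def)
  \<comment> \<open>\<open>Z\<close> is abelian because \<open>i\<close> embeds it in the centre of
    \<open>G\<close>.\<close>
  have "x \<otimes>\<^bsub>Z\<^esub> y = y \<otimes>\<^bsub>Z\<^esub> x" if "x \<in> carrier Z" "y \<in> carrier Z" for x y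
  proof (rule inj_onD[OF i(2)])
    have "i x \<otimes>\<^bsub>G\<^esub> i y = i y \<otimes>\<^bsub>G\<^esub> i x" using cen that by (auto simp: group_centre_def)
    then show "i (x \<otimes>\<^bsub>Z\<^esub> y) = i (y \<otimes>\<^bsub>Z\<^esub> x)" using that by simp
  qed (use that in auto)
  then interpret Z: comm_group Z
    by (rule group.group_comm_groupI[OF gZ])
  obtain X where X: "finite X" "X \<subseteq> carrier Z" "carrier Z = generate Z X"
    using assms(2) by (auto simp: fg_group_def fg_subgroup_def)
  \<comment> \<open>A subgroup of the kernel is the image under \<open>i\<close> of its preimage in
    \<open>Z\<close>, which is finitely generated because \<open>Z\<close> is a finitely generated
    abelian group.\<close>
  have "fg_subgroup G T" if T: "subgroup T G" "T \<subseteq> kernel G Q p" for T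
  proof -
    let ?V = "{x \<in> carrier Z. i x \<in> T}"
    have "subgroup ?V Z"
      using T(1) subgroup.one_closed[OF T(1)] i.G.one_closed i.hom_one
      by (intro i.G.subgroupI)
        (auto simp: subgroup.m_closed subgroup.m_inv_closed simp del: i.G.one_closed)
    then have "fg_subgroup Z ?V"
      using X by (intro Z.fg_subgroup_of_generate[OF X(1,2)]) auto
    moreover have "i ` ?V = T" using T(2) ker by auto
    ultimately show ?thesis using i.fg_subgroup_image by metis
  qed
  then show "double_coset_separable G"
    using cen ker by (intro p.double_coset_separable_central_kernel[OF assms(1) sepG]) auto
qed

end
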